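(* Let $S$ be an $AG^{*}$-groupoid. Then $S$ is left nuclear square, i.e. $a^{2}(bc)=(a^{2}b)c$ for all $a,b,c\in S$.
   Context: A groupoid is a set $S$ with a binary operation, written as juxtaposition; no associativity or commutativity is assumed, and $a^{2}$ denotes $aa$. An AG-groupoid is a groupoid $S$ satisfying the left invertive law $(ab)c=(cb)a$ for all $a,b,c\in S$. An $AG^{*}$-groupoid is an AG-groupoid satisfying $(ab)c=b(ac)$ for all $a,b,c\in S$. An AG-groupoid $S$ is left nuclear square if $a^{2}(bc)=(a^{2}b)c$ for all $a,b,c\in S$. *)

theory Defs
  imports Main
begin

(* A carrier set closed under a binary operation. The carrier may be empty and may be a
   proper subset of the type; the operation is unconstrained outside the carrier. *)
locale groupoid =
  fixes S :: "'a set"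
    and mult :: "'a \<Rightarrow> 'a \<Rightarrow> 'a"  (infixl "\<cdot>" 70)
  assumes closed: "\<lbrakk>a \<in> S; b \<in> S\<rbrakk> \<Longrightarrow> a \<cdot> b \<in> S"

locale AG_groupoid = groupoid +
  assumes left_invertive:
    "\<lbrakk>a \<in> S; b \<in> S; c \<in> S\<rbrakk> \<Longrightarrow> (a \<cdot> b) \<cdot> c = (c \<cdot> b) \<cdot> a"

locale AG_star_groupoid = AG_groupoid +
  assumes AG_star:
    "\<lbrakk>a \<in> S; b \<in> S; c \<in> S\<rbrakk> \<Longrightarrow> (a \<cdot> b) \<cdot> c = b \<cdot> (a \<cdot> c)"

locale left_nuclear_square_AG_groupoid = AG_groupoid +
  assumes left_nuclear_square:
    "\<lbrakk>a \<in> S; b \<in> S; c \<in> S\<rbrakk> \<Longrightarrow> (a \<cdot> a) \<cdot> (b \<cdot> c) = ((a \<cdot> a) \<cdot> b) \<cdot> c"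

end

theory Submission
  imports Defs
begin

text \<open>The square \<open>a a\<close> can be taken apart and rebuilt: the AG* law, read from
  right to left, separates its two factors. Left inversion then exchanges the inner \<open>a\<close>
  with \<open>b\<close>, forming \<open>b c\<close>, and once more exchanges \<open>b c\<close> with
  the outer \<open>a\<close>, restoring the square in front.\<close>

theorem corollary8:
  fixes S :: "'a set"
    and mult :: "'a \<Rightarrow> 'a \<Rightarrow> 'a"
  assumes "AG_star_groupoid S mult"
  shows "left_nuclear_square_AG_groupoid S mult"
proof -
  interpret AG_star_groupoid S mult by (fact assms)
  show ?thesis
  proof unfold_locales
    fix a b c assume abc: "a \<in> S" "b \<in> S" "c \<in> S"
    have "mult (mult (mult a a) b) c = mult (mult c b) (mult a a)"
      by (rule left_invertive) (simp_all add: abc closed)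
    also have "\<dots> = mult b (mult c (mult a a))"
      by (rule AG_star) (simp_all add: abc closed)
    \<comment> \<open>The square is split here: one \<open>a\<close> moves to the left of
      \<open>c\<close>, the other stays at the right end.\<close>
    also have "mult c (mult a a) = mult (mult a c) a"
      by (rule AG_star [symmetric]) (simp_all add: abc)
    also have "mult b (mult (mult a c) a) = mult (mult (mult a c) b) a"
      by (rule AG_star [symmetric]) (simp_all add: abc closed)
    also have "mult (mult a c) b = mult (mult b c) a"
      by (rule left_invertive) (simp_all add: abc)
    \<comment> \<open>With both copies of \<open>a\<close> now to the right of \<open>b c\<close>,
      left inversion reunites them.\<close>
    also have "mult (mult (mult b c) a) a = mult (mult a a) (mult b c)"
      by (rule left_invertive) (simp_all add: abc closed)
    finally show "mult (mult a a) (mult b c) = mult (mult (mult a a) b) c"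
      by (rule sym)
  qed
qed

end
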